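(* Let $d\in\mathbb{N}$, let $L$ be a Banach limit, and let $A$ be a positive definite (i.e. positive semi-definite and invertible) $d\times d$ complex matrix. The following statements are equivalent: (i) $A$ is the Cesàro asymptotic limit of some $T\in C_{11}(\mathbb{C}^d)$, i.e. $A=A_{T,C}$; (ii) $A$ is the $L$-asymptotic limit of some $T\in C_{11}(\mathbb{C}^d)$, i.e. $A=A_{T,L}$; (iii) if $t_1,\dots,t_d>0$ are the eigenvalues of $A$ counted with multiplicity, then $$\frac1{t_1}+\dots+\frac1{t_d}=d;$$ (iv) there is an invertible $d\times d$ complex matrix $S$ whose column vectors are all unit vectors such that $$A=(S^{*})^{-1}S^{-1}=(SS^* )^{-1}.$$
   Context: $\mathbb{C}^d$ carries the usual inner product; matrices are identified with operators on $\mathbb{C}^d$. A matrix $T$ is powerbounded if there is $M>0$ with $\|T^n\|<M$ for all $n\in\mathbb{N}=\{1,2,\dots\}$ (operator norm). A Banach limit is a bounded linear functional $L:\ell^\infty\to\mathbb{C}$ on bounded complex sequences such that $\|L\|=1$, $L(x)=\lim_n x_n$ for every convergent sequence $x$, $L$ is positive ($x_n\ge 0$ for all $n$ implies $L(x)\ge0$), and $L$ is shift-invariant ($L((x_n)_n)=L((x_{n+1})_n)$). For powerbounded $T$ and a Banach limit $L$, the $L$-asymptotic limit $A_{T,L}$ is the unique positive operator with $\langle A_{T,L}x,y\rangle = L\big((\langle T^nx,T^ny\rangle)_{n\ge1}\big)$ for all $x,y$ (for matrices: the entrywise $L$-limit of $T^{*n}T^n$). Its kernel is $\{x: T^nx\to0\}$,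 which does not depend on $L$. The Cesàro asymptotic limit of a matrix $T$ is $A_{T,C}=\lim_{n\to\infty}\frac1n\sum_{j=1}^n T^{*j}T^j$ (entrywise limit), if this limit exists. $C_{11}(\mathbb{C}^d)$ is the set of powerbounded $d\times d$ matrices $T$ such that both $A_{T,L}$ and $A_{T^*,L}$ are injective (equivalently, invertible). *)

theory Defs
  imports
    "HOL-Analysis.Analysis"
    "HOL-Computational_Algebra.Polynomial"
begin

unbundle no fps_syntax

definition cinner :: "complex ^ 'n \<Rightarrow> complex ^ 'n \<Rightarrow> complex" where
  "cinner x y = (\<Sum>i\<in>UNIV. x $ i * cnj (y $ i))"

definition conj_transpose :: "complex ^ 'n ^ 'm \<Rightarrow> complex ^ 'm ^ 'n" where
  "conj_transpose A = map_matrix cnj (transpose A)"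

text \<open>The overloaded power on \<open>complex ^ 'n ^ 'n\<close> is the entrywise one, not the power with
  respect to matrix multiplication, hence the following function.\<close>

primrec mat_pow :: "complex ^ 'n ^ 'n \<Rightarrow> nat \<Rightarrow> complex ^ 'n ^ 'n" where
  "mat_pow T 0 = mat 1"
| "mat_pow T (Suc n) = T ** mat_pow T n"

text \<open>Over the complex numbers, the condition below forces the matrix to be Hermitian.\<close>

definition positive_op :: "complex ^ 'n ^ 'n \<Rightarrow> bool" where
  "positive_op A \<longleftrightarrow> (\<forall>x. cinner (A *v x) x \<in> \<real>\<^sub>\<ge>\<^sub>0)"

definition positive_definite :: "complex ^ 'n ^ 'n \<Rightarrow> bool" where
  "positive_definite A \<longleftrightarrow> positive_op A \<and> invertible A"

definition charpoly :: "complex ^ 'n ^ 'n \<Rightarrow> complex poly" where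
  "charpoly A = det (mat [:0, 1:] - map_matrix (\<lambda>a. [:a:]) A)"

definition eigenvalues :: "complex ^ 'n ^ 'n \<Rightarrow> complex multiset" where
  "eigenvalues A = proots (charpoly A)"

definition powerbounded :: "complex ^ 'n ^ 'n \<Rightarrow> bool" where
  "powerbounded T \<longleftrightarrow> (\<exists>M>0. \<forall>n\<ge>1. onorm ((*v) (mat_pow T n)) < M)"

text \<open>Since \<open>nat\<close> is discrete, \<open>nat \<Rightarrow>\<^sub>C complex\<close> is the space of all bounded complex sequences
  with the supremum norm. It is only a real normed space in the library, so complex homogeneity
  is required separately. Sequences indexed by 1, 2, ... have their n-th term at index n - 1.\<close>

definition banach_limit :: "((nat \<Rightarrow>\<^sub>C complex) \<Rightarrow> complex) \<Rightarrow> bool" where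
  "banach_limit L \<longleftrightarrow>
     bounded_linear L \<and>
     (\<forall>c x. L (Bcontfun (\<lambda>n. c * apply_bcontfun x n)) = c * L x) \<and>
     onorm L = 1 \<and>
     (\<forall>x l. apply_bcontfun x \<longlonglongrightarrow> l \<longrightarrow> L x = l) \<and>
     (\<forall>x. (\<forall>n. apply_bcontfun x n \<in> \<real>\<^sub>\<ge>\<^sub>0) \<longrightarrow> L x \<in> \<real>\<^sub>\<ge>\<^sub>0) \<and>
     (\<forall>x. L (Bcontfun (\<lambda>n. apply_bcontfun x (Suc n))) = L x)"

definition orbit_inner :: "complex ^ 'n ^ 'n \<Rightarrow> complex ^ 'n \<Rightarrow> complex ^ 'n \<Rightarrow> nat \<Rightarrow> complex" where
  "orbit_inner T x y n = cinner (mat_pow T n *v x) (mat_pow T n *v y)"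

definition is_asymptotic_limit ::
  "((nat \<Rightarrow>\<^sub>C complex) \<Rightarrow> complex) \<Rightarrow> complex ^ 'n ^ 'n \<Rightarrow> complex ^ 'n ^ 'n \<Rightarrow> bool" where
  "is_asymptotic_limit L T A \<longleftrightarrow>
     positive_op A \<and>
     (\<forall>x y. cinner (A *v x) y = L (Bcontfun (\<lambda>n. orbit_inner T x y (Suc n))))"

definition asymptotic_limit ::
  "((nat \<Rightarrow>\<^sub>C complex) \<Rightarrow> complex) \<Rightarrow> complex ^ 'n ^ 'n \<Rightarrow> complex ^ 'n ^ 'n" where
  "asymptotic_limit L T = (THE A. is_asymptotic_limit L T A)"

definition is_cesaro_asymptotic_limit :: "complex ^ 'n ^ 'n \<Rightarrow> complex ^ 'n ^ 'n \<Rightarrow> bool" where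
  "is_cesaro_asymptotic_limit T A \<longleftrightarrow>
     (\<lambda>n. (1 / real n) *\<^sub>R (\<Sum>j=1..n. mat_pow (conj_transpose T) j ** mat_pow T j))
       \<longlonglongrightarrow> A"

text \<open>The kernel of the asymptotic limit is the set of vectors with orbit tending to 0, so for a
  Banach limit \<open>L\<close> the set below does not depend on \<open>L\<close>.\<close>

definition C11 :: "((nat \<Rightarrow>\<^sub>C complex) \<Rightarrow> complex) \<Rightarrow> (complex ^ 'n ^ 'n) set" where
  "C11 L = {T. powerbounded T \<and>
     inj ((*v) (asymptotic_limit L T)) \<and>
     inj ((*v) (asymptotic_limit L (conj_transpose T)))}"

text \<open>Well-definedness of the definite description in \<open>asymptotic_limit\<close>.\<close>

lemma cinner_axis: "cinner x (axis i 1) = x $ i"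
  by (simp add: cinner_def axis_def if_distrib cong: if_cong)

lemma mat_pow_bound:
  fixes T :: "complex ^ 'n ^ 'n"
  assumes "powerbounded T"
  obtains M where "M > 0" "\<And>n x. norm (mat_pow T (Suc n) *v x) \<le> M * norm x"
proof -
  from assms obtain M where M: "M > 0" "\<And>n. n \<ge> 1 \<Longrightarrow> onorm ((*v) (mat_pow T n)) < M"
    unfolding powerbounded_def by blast
  have "norm (mat_pow T (Suc n) *v x) \<le> M * norm x" for n x
  proof -
    have "bounded_linear ((*v) (mat_pow T (Suc n)))"
      by (rule matrix_vector_mul_bounded_linear)
    then have "norm (mat_pow T (Suc n) *v x) \<le> onorm ((*v) (mat_pow T (Suc n))) * norm x"
      by (rule onorm)
    also have "\<dots> \<le> M * norm x"
      using M(2)[of "Suc n"] by (intro mult_right_mono) auto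
    finally show ?thesis .
  qed
  with M(1) show thesis using that by blast
qed

lemma norm_cinner_le: "norm (cinner x y) \<le> real CARD('n) * (norm x * norm (y :: complex ^ 'n))"
proof -
  have "norm (x $ i * cnj (y $ i)) \<le> norm x * norm y" for i
    by (simp add: norm_mult mult_mono Finite_Cartesian_Product.norm_nth_le)
  then have "norm (cinner x y) \<le> (\<Sum>i\<in>(UNIV :: 'n set). norm x * norm y)"
    unfolding cinner_def by (intro sum_norm_le) auto
  then show ?thesis by simp
qed

lemma orbit_inner_bcontfun:
  fixes T :: "complex ^ 'n ^ 'n"
  assumes "powerbounded T"
  shows "(\<lambda>n. orbit_inner T x y (Suc n)) \<in> bcontfun"
proof -
  obtain M where M: "M > 0" "\<And>n x. norm (mat_pow T (Suc n) *v x) \<le> M * norm x"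
    using mat_pow_bound[OF assms] by blast
  have "norm (orbit_inner T x y (Suc n)) \<le> real CARD('n) * ((M * norm x) * (M * norm y))" for n
  proof -
    have "norm (orbit_inner T x y (Suc n))
        \<le> real CARD('n) * (norm (mat_pow T (Suc n) *v x) * norm (mat_pow T (Suc n) *v y))"
      unfolding orbit_inner_def by (rule norm_cinner_le)
    also have "\<dots> \<le> real CARD('n) * ((M * norm x) * (M * norm y))"
      using M by (intro mult_left_mono mult_mono) auto
    finally show ?thesis .
  qed
  then have "bounded (range (\<lambda>n. orbit_inner T x y (Suc n)))"
    by (intro boundedI) auto
  then show ?thesis
    by (simp add: bcontfun_def)
qed

lemma orbit_inner_expand:
  fixes T :: "complex ^ 'n ^ 'n"
  shows "orbit_inner T x y n =
    (\<Sum>i\<in>UNIV. \<Sum>j\<in>UNIV. (x $ j * cnj (y $ i)) * orbit_inner T (axis j 1) (axis i 1) n)"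
proof -
  let ?P = "mat_pow T n"
  have col: "(?P *v axis j 1) $ k = ?P $ k $ j" for j k
    by (simp add: matrix_vector_mult_def axis_def if_distrib cong: if_cong)
  have "orbit_inner T x y n
      = (\<Sum>k\<in>UNIV. \<Sum>j\<in>UNIV. \<Sum>i\<in>UNIV. (x $ j * cnj (y $ i)) * (?P $ k $ j * cnj (?P $ k $ i)))"
    unfolding orbit_inner_def cinner_def matrix_vector_mult_def
    by (simp add: cnj_sum sum_product mult_ac)
  also have "\<dots> = (\<Sum>k\<in>UNIV. \<Sum>i\<in>UNIV. \<Sum>j\<in>UNIV. (x $ j * cnj (y $ i)) * (?P $ k $ j * cnj (?P $ k $ i)))"
    by (intro sum.cong refl sum.swap)
  also have "\<dots> = (\<Sum>i\<in>UNIV. \<Sum>k\<in>UNIV. \<Sum>j\<in>UNIV. (x $ j * cnj (y $ i)) * (?P $ k $ j * cnj (?P $ k $ i)))"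
    by (rule sum.swap)
  also have "\<dots> = (\<Sum>i\<in>UNIV. \<Sum>j\<in>UNIV. \<Sum>k\<in>UNIV. (x $ j * cnj (y $ i)) * (?P $ k $ j * cnj (?P $ k $ i)))"
    by (intro sum.cong refl sum.swap)
  finally show ?thesis
    by (simp add: orbit_inner_def cinner_def col sum_distrib_left)
qed

lemma ex1_asymptotic_limit:
  fixes T :: "complex ^ 'n ^ 'n"
  assumes L: "banach_limit L" and T: "powerbounded T"
  shows "\<exists>!A. is_asymptotic_limit L T A"
proof (rule ex_ex1I)
  fix A B assume "is_asymptotic_limit L T A" "is_asymptotic_limit L T B"
  then have "(A *v x) $ i = (B *v x) $ i" for x i
    unfolding is_asymptotic_limit_def by (metis cinner_axis)
  then show "A = B"
    by (simp add: matrix_eq vec_eq_iff)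
next
  define s where "s x y = Bcontfun (\<lambda>n. orbit_inner T x y (Suc n))" for x y
  have s: "apply_bcontfun (s x y) n = orbit_inner T x y (Suc n)" for x y n
    unfolding s_def using Bcontfun_inverse[OF orbit_inner_bcontfun[OF T]] by simp
  define A :: "complex ^ 'n ^ 'n" where "A = (\<chi> i j. L (s (axis j 1) (axis i 1)))"
  define m where "m c z = Bcontfun (\<lambda>n. c * apply_bcontfun z n)" for c and z :: "nat \<Rightarrow>\<^sub>C complex"
  have m: "apply_bcontfun (m c z) n = c * apply_bcontfun z n" for c z n
  proof -
    have "bounded (range (\<lambda>n. c * apply_bcontfun z n))"
      using bounded_linear_image[OF bounded_apply_bcontfun[of z] bounded_linear_mult_right[of c]]
      by (simp add: image_image)
    then have "(\<lambda>n. c * apply_bcontfun z n) \<in> bcontfun" by (simp add: bcontfun_def)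
    from Bcontfun_inverse[OF this] show ?thesis by (simp add: m_def)
  qed
  have Lm: "L (m c z) = c * L z" for c z
    using L unfolding banach_limit_def m_def by blast
  have lin: "linear L"
    using L by (simp add: banach_limit_def bounded_linear.linear)
  have app_sum: "apply_bcontfun (sum f I) n = (\<Sum>i\<in>I. apply_bcontfun (f i) n)"
    for f :: "'n \<Rightarrow> nat \<Rightarrow>\<^sub>C complex" and I n
    by (induction I rule: infinite_finite_induct) auto
  have form: "cinner (A *v x) y = L (s x y)" for x y
  proof -
    have "s x y = (\<Sum>i\<in>UNIV. \<Sum>j\<in>UNIV. m (x $ j * cnj (y $ i)) (s (axis j 1) (axis i 1)))"
      by (rule bcontfun_eqI, subst s, subst orbit_inner_expand) (simp only: app_sum s m)
    then have "L (s x y) = L (\<Sum>i\<in>UNIV. \<Sum>j\<in>UNIV. m (x $ j * cnj (y $ i)) (s (axis j 1) (axis i 1)))"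
      by (rule arg_cong)
    also have "\<dots> = (\<Sum>i\<in>UNIV. \<Sum>j\<in>UNIV. (x $ j * cnj (y $ i)) * L (s (axis j 1) (axis i 1)))"
      by (simp add: linear_sum[OF lin] Lm)
    also have "\<dots> = cinner (A *v x) y"
      by (simp add: cinner_def A_def matrix_vector_mult_def sum_distrib_left sum_distrib_right mult_ac)
    finally show ?thesis by simp
  qed
  have pos: "L (s x x) \<in> \<real>\<^sub>\<ge>\<^sub>0" for x
  proof -
    have "cinner z z \<in> \<real>\<^sub>\<ge>\<^sub>0" for z :: "complex ^ 'n"
      unfolding cinner_def complex_norm_square[symmetric]
      by (simp only: of_real_sum[symmetric] nonneg_Reals_of_real_iff) (simp add: sum_nonneg)
    then have "\<forall>n. apply_bcontfun (s x x) n \<in> \<real>\<^sub>\<ge>\<^sub>0"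
      by (simp add: s orbit_inner_def)
    then show ?thesis
      using L unfolding banach_limit_def by blast
  qed
  have "is_asymptotic_limit L T A"
    unfolding is_asymptotic_limit_def positive_op_def using form pos by (simp add: s_def)
  then show "\<exists>A. is_asymptotic_limit L T A" ..
qed

end

theory Submission
  imports Defs "HOL-Computational_Algebra.Fundamental_Theorem_Algebra"
begin

text \<open>The eigenvalue condition says \<open>tr A\<^sup>-\<^sup>1 = d\<close>. Every Banach or Cesaro limit \<open>A\<close> satisfies
  \<open>T\<^sup>* A T = A\<close>, so \<open>tr (A\<^sup>-\<^sup>1 T\<^sup>*\<^sup>n T\<^sup>n) = tr A\<^sup>-\<^sup>1\<close> for all \<open>n\<close>, and passing to the limit gives
  \<open>d = tr A\<^sup>-\<^sup>1\<close>. Conversely, if \<open>A\<^sup>-\<^sup>1 = S S\<^sup>*\<close> has trace \<open>d\<close>, the mean of the squared column norms of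
  \<open>S\<close> is 1, and rotating a column shorter than 1 against one longer than 1 leaves \<open>S S\<^sup>*\<close> unchanged
  and increases the number of unit columns until all are unit vectors. Finally \<open>T = S U S\<^sup>-\<^sup>1\<close> with
  \<open>U\<close> diagonal with distinct unimodular entries has both limits equal to \<open>A\<close>, because averaging
  \<open>U\<^sup>*\<^sup>n (S\<^sup>* S) U\<^sup>n\<close> kills the off-diagonal entries.\<close>

subsection \<open>Reciprocal eigenvalues and the trace of the inverse\<close>

lemma poly_det: "poly (det M) x = det (map_matrix (\<lambda>p. poly p x) M)"
  by (simp add: det_def poly_sum poly_prod map_matrix_def)

lemma coeff_1_prod:
  fixes f :: "'i \<Rightarrow> 'a :: comm_ring_1"
  assumes "finite I"
  shows "coeff (\<Prod>i\<in>I. [:1, f i:]) 0 = 1 \<and> coeff (\<Prod>i\<in>I. [:1, f i:]) 1 = (\<Sum>i\<in>I. f i)"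
  using assms by (induction I rule: finite_induct) (auto simp: coeff_pCons)

text \<open>This is \<open>det (1 - X M)\<close>, the characteristic polynomial with reversed
  coefficients. For \<open>M = A\<^sup>-\<^sup>1\<close> it brings the trace of the inverse down to
  the linear coefficient.\<close>

definition recip_charpoly :: "complex ^ 'n ^ 'n \<Rightarrow> complex poly" where
  "recip_charpoly M = det (\<chi> i j. [:if i = j then 1 else 0, - (M $ i $ j):])"

text \<open>Every non-identity permutation moves at least two indices, so its term in the Leibniz
  formula is divisible by the square of the variable.\<close>

lemma coeff_recip_charpoly:
  fixes M :: "complex ^ 'n ^ 'n"
  shows "coeff (recip_charpoly M) 0 = 1" "coeff (recip_charpoly M) 1 = - trace M"
proof -
  define t where "t p = of_int (sign p) *
    (\<Prod>i\<in>UNIV. [:if i = p i then 1 else 0, - (M $ i $ p i):])" for p :: "'n \<Rightarrow> 'n"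
  let ?P = "{p :: 'n \<Rightarrow> 'n. p permutes UNIV}"
  have "coeff (t p) k = 0" if p: "p \<in> ?P - {id}" and "k < 2" for p k
  proof -
    obtain i where i: "p i \<noteq> i"
      using p by (auto simp: fun_eq_iff)
    have "inj p"
      using p permutes_inj by auto
    then have pi: "p (p i) \<noteq> p i"
      using i by (auto dest: injD)
    have X: "monom 1 1 dvd [:if j = p j then 1 else 0, - (M $ j $ p j):]" if "p j \<noteq> j" for j
      using that by (simp add: monom_1_dvd_iff')
    have "monom 1 2 = (monom 1 1 * monom 1 1 :: complex poly)"
      by (simp add: mult_monom numeral_2_eq_2)
    also have "\<dots> dvd (\<Prod>j\<in>{i, p i}. [:if j = p j then 1 else 0, - (M $ j $ p j):])"
      using mult_dvd_mono[OF X[OF i] X[OF pi]] i by simp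
    also have "\<dots> dvd (\<Prod>j\<in>UNIV. [:if j = p j then 1 else 0, - (M $ j $ p j):])"
      by (rule prod_dvd_prod_subset) auto
    also have "\<dots> dvd t p"
      unfolding t_def by (rule dvd_triv_right)
    finally show ?thesis
      using \<open>k < 2\<close> monom_1_dvd_iff' by blast
  qed
  then have "coeff (sum t ?P) k = coeff (t id) k" if "k < 2" for k
    using that by (subst sum.remove[of _ id]) (auto simp: permutes_id finite_permutations coeff_sum)
  moreover have "recip_charpoly M = sum t ?P"
    unfolding recip_charpoly_def det_def t_def by simp
  moreover have "coeff (t id) 0 = 1" "coeff (t id) 1 = - trace M"
    unfolding t_def using coeff_1_prod[of UNIV "\<lambda>i. - (M $ i $ i)"]
    by (simp_all add: trace_def sum_negf)
  ultimately show "coeff (recip_charpoly M) 0 = 1" "coeff (recip_charpoly M) 1 = - trace M"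
    by simp_all
qed

lemma invertible_matrix_inv:
  fixes A :: "'a :: field ^ 'n ^ 'n"
  assumes "invertible A"
  shows "A ** matrix_inv A = mat 1" "matrix_inv A ** A = mat 1"
  using someI_ex[OF assms[unfolded invertible_def]] unfolding matrix_inv_def by blast+

lemma matrix_inv_eqI:
  fixes A :: "'a :: field ^ 'n ^ 'n"
  assumes "A ** B = mat 1"
  shows "matrix_inv A = B" "invertible A"
proof -
  show inv: "invertible A"
    using assms invertible_right_inverse by blast
  have "matrix_inv A = matrix_inv A ** (A ** B)"
    by (simp add: assms)
  then show "matrix_inv A = B"
    by (simp add: matrix_mul_assoc invertible_matrix_inv[OF inv])
qed

text \<open>Factor \<open>x - A = - A (1 - x A\<^sup>-\<^sup>1)\<close> and take determinants at
  every point \<open>x\<close>. Over an infinite field, polynomials with equal values are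
  equal.\<close>

lemma charpoly_eq_recip_charpoly:
  fixes A :: "complex ^ 'n ^ 'n"
  assumes "invertible A"
  shows "charpoly A = smult (det (- A)) (recip_charpoly (matrix_inv A))"
proof -
  have "poly (charpoly A) x = det (- A) * poly (recip_charpoly (matrix_inv A)) x" for x
  proof -
    let ?B = "matrix_inv A"
    have "poly (charpoly A) x = det (mat x - A)"
      unfolding charpoly_def poly_det
      by (rule arg_cong[of _ _ det]) (simp add: vec_eq_iff map_matrix_def mat_def)
    also have "mat x - A = - A ** (mat 1 - map_matrix ((*) x) ?B)"
    proof -
      have "- A ** (mat 1 - map_matrix ((*) x) ?B) = map_matrix ((*) x) (A ** ?B) - A ** mat 1"
        unfolding matrix_matrix_mult_def vec_eq_iff
        by (simp add: algebra_simps sum.distrib sum_subtractf sum_distrib_left sum_negf map_matrix_def)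
      also have "\<dots> = mat x - A"
        by (simp add: invertible_matrix_inv[OF assms]) (simp add: vec_eq_iff mat_def map_matrix_def)
      finally show ?thesis by simp
    qed
    also have "det \<dots> = det (- A) * det (mat 1 - map_matrix ((*) x) ?B)"
      by (rule det_mul)
    also have "det (mat 1 - map_matrix ((*) x) ?B) = poly (recip_charpoly ?B) x"
      unfolding recip_charpoly_def poly_det
      by (rule arg_cong[of _ _ det]) (simp add: vec_eq_iff map_matrix_def mat_def)
    finally show ?thesis .
  qed
  then show ?thesis
    by (intro poly_eq_poly_eq_iff[THEN iffD1] ext) simp
qed

text \<open>The logarithmic derivative of the product at 0 is the sum of the terms
  \<open>1 / (0 - t)\<close>; here the denominator is cleared.\<close>

lemma coeff_1_prod_mset:
  fixes T :: "'a :: field multiset"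
  assumes "0 \<notin># T"
  shows "coeff (\<Prod>t\<in>#T. [:- t, 1:]) 1 = - coeff (\<Prod>t\<in>#T. [:- t, 1:]) 0 * (\<Sum>t\<in>#T. 1 / t)"
  using assms by (induction T) (auto simp: coeff_pCons algebra_simps)

text \<open>The ratio of the linear to the constant coefficient of the characteristic polynomial is
  computed twice: from its roots, and from the reversed polynomial of the inverse.\<close>

lemma sum_inverse_eigenvalues:
  fixes A :: "complex ^ 'n ^ 'n"
  assumes "invertible A"
  shows "(\<Sum>t\<in>#eigenvalues A. 1 / t) = trace (matrix_inv A)"
proof -
  define p where "p = charpoly A"
  let ?q = "\<Prod>t\<in>#proots p. [:- t, 1:]"
  define s where "s = (\<Sum>t\<in>#proots p. 1 / t)"
  define c where "c = det (- A)"
  have p0: "coeff p 0 = c" and p1: "coeff p 1 = - c * trace (matrix_inv A)"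
    unfolding p_def charpoly_eq_recip_charpoly[OF assms] c_def
    by (simp_all only: coeff_smult coeff_recip_charpoly) auto
  have "(- A) ** (- matrix_inv A) = A ** matrix_inv A"
    by (simp add: matrix_matrix_mult_def)
  then have "invertible (- A)"
    by (metis invertible_matrix_inv(1)[OF assms] invertible_right_inverse)
  then have c: "c \<noteq> 0"
    by (simp add: c_def invertible_det_nz)
  then have "p \<noteq> 0" using p0 by auto
  \<comment> \<open>The constant coefficient is \<open>det (- A)\<close>, so 0 is not a root and
    every \<open>1 / t\<close> is a genuine reciprocal.\<close>
  moreover have "poly p 0 \<noteq> 0"
    using c p0 by (simp add: poly_0_coeff_0)
  ultimately have "0 \<notin># proots p" by simp
  then have "lead_coeff p * coeff ?q 1 = - (lead_coeff p * coeff ?q 0) * s"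
    unfolding s_def by (subst coeff_1_prod_mset) simp_all
  moreover have "coeff (smult (lead_coeff p) ?q) k = coeff p k" for k
    by (simp only: complex_poly_decompose_multiset)
  ultimately have "coeff p 1 = - coeff p 0 * s"
    by (simp only: coeff_smult)
  then have "c * trace (matrix_inv A) = c * s"
    using p0 p1 by auto
  with c show ?thesis
    by (simp add: s_def eigenvalues_def p_def)
qed

subsection \<open>Invariance of asymptotic limits\<close>

lemma conj_transpose_nth [simp]: "conj_transpose M $ i $ j = cnj (M $ j $ i)"
  by (simp add: conj_transpose_def map_matrix_def transpose_def)

lemma conj_transpose_mult: "conj_transpose (M ** N) = conj_transpose N ** conj_transpose M"
  by (simp add: vec_eq_iff matrix_matrix_mult_def mult.commute)

lemma conj_transpose_conj_transpose [simp]: "conj_transpose (conj_transpose M) = M"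
  by (simp add: vec_eq_iff)

lemma conj_transpose_mat_1 [simp]: "conj_transpose (mat 1) = mat 1"
  by (simp add: vec_eq_iff mat_def)

lemma mat_pow_commute: "mat_pow T n ** T = T ** mat_pow T n"
  by (induction n) (simp_all add: matrix_mul_assoc[symmetric])

lemma mat_pow_conj_transpose: "mat_pow (conj_transpose T) n = conj_transpose (mat_pow T n)"
  by (induction n) (simp_all add: conj_transpose_mult[symmetric] mat_pow_commute)

lemma cinner_matrix_left: "cinner (M *v x) y = cinner x (conj_transpose M *v y)"
  unfolding cinner_def matrix_vector_mult_def
  by (simp add: sum_distrib_left sum_distrib_right mult_ac) (rule sum.swap)

lemma cinner_add_left: "cinner (x + y) z = cinner x z + cinner y z"
  by (simp add: cinner_def algebra_simps sum.distrib)

lemma cinner_add_right: "cinner x (y + z) = cinner x y + cinner x z"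
  by (simp add: cinner_def algebra_simps sum.distrib)

lemma cinner_zero_left [simp]: "cinner 0 y = 0"
  by (simp add: cinner_def)

lemma cinner_scale_left: "cinner (c *s x) y = c * cinner x y"
  by (simp add: cinner_def algebra_simps sum_distrib_left)

lemma cinner_scale_right: "cinner x (c *s y) = cnj c * cinner x y"
  by (simp add: cinner_def algebra_simps sum_distrib_left)

lemma cinner_commute: "cinner y x = cnj (cinner x y)"
  by (simp add: cinner_def mult.commute)

lemma norm_vec_square: "(norm x)\<^sup>2 = (\<Sum>i\<in>UNIV. (norm (x $ i))\<^sup>2)" for x :: "complex ^ 'n"
  by (simp add: norm_vec_def L2_set_def sum_nonneg)

lemma cinner_self: "cinner x x = of_real ((norm x)\<^sup>2)"
  unfolding cinner_def norm_vec_square of_real_sum complex_norm_square ..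

lemma matrix_mult_axis: "M *v axis j 1 = column j M" for M :: "complex ^ 'n ^ 'm"
  by (simp add: vec_eq_iff column_def matrix_vector_mult_def axis_def if_distrib cong: if_cong)

lemma cinner_axis_matrix: "cinner (M *v axis j 1) (axis i 1) = M $ i $ j"
  by (simp add: cinner_axis matrix_mult_axis column_def)

lemma matrix_eqI_cinner:
  fixes M N :: "complex ^ 'n ^ 'n"
  assumes "\<And>x y. cinner (M *v x) y = cinner (N *v x) y"
  shows "M = N"
  using assms[of "axis _ 1" "axis _ 1"] by (simp add: cinner_axis_matrix vec_eq_iff)

lemma orbit_inner_alt: "orbit_inner T x y n = cinner ((mat_pow (conj_transpose T) n ** mat_pow T n) *v x) y"
  unfolding orbit_inner_def mat_pow_conj_transpose matrix_vector_mul_assoc[symmetric]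
  by (simp add: cinner_matrix_left)

lemma orbit_inner_axis: "orbit_inner T (axis j 1) (axis i 1) n
    = (mat_pow (conj_transpose T) n ** mat_pow T n) $ i $ j"
  by (simp add: orbit_inner_alt cinner_axis_matrix)

text \<open>Since \<open>T\<close> is unitary for the inner product given by \<open>A\<close>, one has \<open>T A\<^sup>-\<^sup>1 T\<^sup>* = A\<^sup>-\<^sup>1\<close>.\<close>

lemma trace_invariant:
  fixes T A :: "complex ^ 'n ^ 'n"
  assumes "invertible A" and inv: "conj_transpose T ** A ** T = A"
  shows "trace (matrix_inv A ** (mat_pow (conj_transpose T) n ** mat_pow T n)) = trace (matrix_inv A)"
proof -
  let ?B = "matrix_inv A"
  note AB = invertible_matrix_inv[OF assms(1)]
  \<comment> \<open>Invariance exhibits a left inverse of \<open>T\<close>. For square matrices it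
    is also a right inverse, and multiplying by \<open>?B\<close> on the right cancels
    \<open>A\<close>.\<close>
  have "(?B ** conj_transpose T ** A) ** T = mat 1"
    using inv AB by (simp add: matrix_mul_assoc[symmetric])
  then have "T ** (?B ** conj_transpose T ** A) = mat 1"
    by (simp add: matrix_left_right_inverse)
  then have "T ** (?B ** conj_transpose T ** A) ** ?B = ?B"
    by simp
  then have *: "T ** ?B ** conj_transpose T = ?B"
    by (simp add: matrix_mul_assoc[symmetric] AB)
  have "mat_pow T n ** ?B ** conj_transpose (mat_pow T n) = ?B"
  proof (induction n)
    case (Suc n)
    have "mat_pow T (Suc n) ** ?B ** conj_transpose (mat_pow T (Suc n))
        = T ** (mat_pow T n ** ?B ** conj_transpose (mat_pow T n)) ** conj_transpose T"
      by (simp add: conj_transpose_mult matrix_mul_assoc)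
    then show ?case by (simp only: Suc *)
  qed simp
  \<comment> \<open>Cyclicity of the trace moves \<open>mat_pow T n\<close> to the front, which
    produces the conjugate of \<open>?B\<close> just computed.\<close>
  then show ?thesis
    using trace_mul_sym[of "?B ** conj_transpose (mat_pow T n)" "mat_pow T n"]
    by (simp add: mat_pow_conj_transpose matrix_mul_assoc)
qed

lemma trace_matrix_mult: "trace (M ** N) = (\<Sum>i\<in>UNIV. \<Sum>j\<in>UNIV. M $ i $ j * N $ j $ i)"
  by (simp add: trace_def matrix_matrix_mult_def)

lemma continuous_trace_mult:
  fixes M :: "complex ^ 'n ^ 'n"
  assumes "X \<longlonglongrightarrow> A"
  shows "(\<lambda>n. trace (M ** X n)) \<longlonglongrightarrow> trace (M ** A)"
  unfolding trace_matrix_mult by (intro tendsto_intros assms)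

lemma bcontfun_mult:
  fixes f :: "nat \<Rightarrow> complex"
  assumes "f \<in> bcontfun"
  shows "(\<lambda>n. c * f n) \<in> bcontfun"
  using assms bounded_linear_image[OF _ bounded_linear_mult_right[of c], of "range f"]
  by (simp add: bcontfun_def image_image)

section \<open>Banach limits of sequences and of matrix orbits\<close>

context
  fixes L :: "(nat \<Rightarrow>\<^sub>C complex) \<Rightarrow> complex"
  assumes L: "banach_limit L"
begin

text \<open>\<open>L\<close> acts on the type of bounded sequences, this version on plain functions.
  \<open>Bcontfun f\<close> is meaningful only for bounded \<open>f\<close>, hence the membership
  assumptions in the rules that follow.\<close>

definition seq_lim :: "(nat \<Rightarrow> complex) \<Rightarrow> complex" where
  "seq_lim f = L (Bcontfun f)"

lemma seq_lim_tendsto: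
  assumes "f \<longlonglongrightarrow> l"
  shows "seq_lim f = l"
proof -
  have "f \<in> bcontfun"
    using convergent_imp_bounded[OF assms] by (simp add: bcontfun_def)
  with assms show ?thesis
    using L unfolding banach_limit_def seq_lim_def by (simp add: Bcontfun_inverse)
qed

lemma seq_lim_const [simp]: "seq_lim (\<lambda>_. c) = c"
  by (rule seq_lim_tendsto) simp

lemma seq_lim_mult:
  assumes "f \<in> bcontfun"
  shows "seq_lim (\<lambda>n. c * f n) = c * seq_lim f"
proof -
  have "L (Bcontfun (\<lambda>n. c * apply_bcontfun x n)) = c * L x" for x
    using L by (simp add: banach_limit_def)
  from this[of "Bcontfun f"] show ?thesis
    by (simp add: seq_lim_def Bcontfun_inverse assms)
qed

lemma seq_lim_Suc:
  assumes "f \<in> bcontfun"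
  shows "seq_lim (\<lambda>n. f (Suc n)) = seq_lim f"
proof -
  have "L (Bcontfun (\<lambda>n. apply_bcontfun x (Suc n))) = L x" for x
    using L by (simp add: banach_limit_def)
  from this[of "Bcontfun f"] show ?thesis
    by (simp add: seq_lim_def Bcontfun_inverse assms)
qed

lemma seq_lim_add:
  assumes "f \<in> bcontfun" "g \<in> bcontfun"
  shows "(\<lambda>n. f n + g n) \<in> bcontfun" "seq_lim (\<lambda>n. f n + g n) = seq_lim f + seq_lim g"
proof -
  show "(\<lambda>n. f n + g n) \<in> bcontfun"
    using assms by (rule plus_cont)
  have "Bcontfun (\<lambda>n. f n + g n) = Bcontfun f + Bcontfun g"
    using assms by (simp add: plus_bcontfun_def Bcontfun_inverse)
  then show "seq_lim (\<lambda>n. f n + g n) = seq_lim f + seq_lim g"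
    using L unfolding seq_lim_def banach_limit_def
    by (simp add: bounded_linear.linear linear_add)
qed

text \<open>Boundedness and value are proved together because splitting off one term requires the
  remaining sum to be bounded.\<close>

lemma seq_lim_sum:
  assumes "\<And>i. i \<in> I \<Longrightarrow> f i \<in> bcontfun"
  shows "(\<lambda>n. \<Sum>i\<in>I. f i n) \<in> bcontfun \<and> seq_lim (\<lambda>n. \<Sum>i\<in>I. f i n) = (\<Sum>i\<in>I. seq_lim (f i))"
  using assms
  by (induction I rule: infinite_finite_induct) (auto simp: seq_lim_add const_bcontfun)

text \<open>Shift invariance multiplies the value at \<open>(z\<^sup>n)\<close> by \<open>z\<close>.\<close>

lemma seq_lim_power:
  assumes "norm z = 1"
  shows "seq_lim (\<lambda>n. z ^ n) = (if z = 1 then 1 else 0)"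
proof (cases "z = 1")
  case False
  have b: "(\<lambda>n. z ^ n) \<in> bcontfun"
    using assms by (auto simp: bcontfun_def norm_power intro!: boundedI[of _ 1])
  from seq_lim_Suc[OF b] seq_lim_mult[OF b, of z] have "(z - 1) * seq_lim (\<lambda>n. z ^ n) = 0"
    by (simp add: algebra_simps)
  with False show ?thesis by simp
qed simp

lemma asymptotic_limit_cinner:
  fixes T :: "complex ^ 'n ^ 'n"
  assumes "powerbounded T"
  shows "cinner (asymptotic_limit L T *v x) y = seq_lim (\<lambda>n. orbit_inner T x y (Suc n))"
  using theI'[OF ex1_asymptotic_limit[OF L assms]]
  unfolding asymptotic_limit_def is_asymptotic_limit_def seq_lim_def by blast

text \<open>Replacing \<open>x\<close> and \<open>y\<close> by \<open>T *v x\<close> and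
  \<open>T *v y\<close> shifts the orbit sequence by one place, which \<open>L\<close> does not
  notice.\<close>

lemma asymptotic_limit_invariant:
  fixes T :: "complex ^ 'n ^ 'n"
  assumes "powerbounded T"
  shows "conj_transpose T ** asymptotic_limit L T ** T = asymptotic_limit L T"
proof (rule matrix_eqI_cinner)
  fix x y :: "complex ^ 'n"
  let ?A = "asymptotic_limit L T"
  have "cinner ((conj_transpose T ** ?A ** T) *v x) y = cinner (?A *v (T *v x)) (T *v y)"
    by (simp add: matrix_vector_mul_assoc[symmetric] cinner_matrix_left[of "conj_transpose T"])
  also have "\<dots> = seq_lim (\<lambda>n. orbit_inner T x y (Suc (Suc n)))"
    unfolding asymptotic_limit_cinner[OF assms]
    by (simp add: orbit_inner_def matrix_vector_mul_assoc mat_pow_commute matrix_mul_assoc[symmetric])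
  also have "\<dots> = cinner (?A *v x) y"
    using seq_lim_Suc[OF orbit_inner_bcontfun[OF assms]] assms by (simp add: asymptotic_limit_cinner)
  finally show "cinner ((conj_transpose T ** ?A ** T) *v x) y = cinner (?A *v x) y" .
qed

text \<open>The traces in \<open>trace_invariant\<close> form a constant sequence. Applying
  \<open>L\<close> term by term turns them into the trace of \<open>A\<^sup>-\<^sup>1 A\<close>, the
  identity matrix.\<close>

lemma trace_inverse_asymptotic_limit:
  fixes T :: "complex ^ 'n ^ 'n"
  assumes T: "powerbounded T" and inv: "invertible (asymptotic_limit L T)"
  shows "trace (matrix_inv (asymptotic_limit L T)) = of_nat CARD('n)"
proof -
  let ?A = "asymptotic_limit L T"
  let ?B = "matrix_inv ?A"
  \<comment> \<open>The vectors are chosen so that the orbit term is the entry at row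
    \<open>j\<close> and column \<open>i\<close>; summing over \<open>i\<close> and \<open>j\<close>
    then gives the trace of a product. \<open>Suc n\<close> reflects that the orbit starts at the
    first power.\<close>
  define f where "f i j n = ?B $ i $ j * orbit_inner T (axis i 1) (axis j 1) (Suc n)" for i j n
  have bc: "f i j \<in> bcontfun" for i j
    unfolding f_def by (intro bcontfun_mult orbit_inner_bcontfun T)
  have "trace ?B = seq_lim (\<lambda>n. \<Sum>i\<in>UNIV. \<Sum>j\<in>UNIV. f i j n)"
    using trace_invariant[OF inv asymptotic_limit_invariant[OF T], of "Suc _"]
    unfolding f_def orbit_inner_axis trace_matrix_mult by (simp only: seq_lim_const)
  also have "\<dots> = (\<Sum>i\<in>UNIV. \<Sum>j\<in>UNIV. seq_lim (f i j))"
    using bc by (simp add: seq_lim_sum)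
  also have "\<dots> = (\<Sum>i\<in>UNIV. \<Sum>j\<in>UNIV. ?B $ i $ j * ?A $ j $ i)"
    unfolding f_def
    by (simp only: seq_lim_mult[OF orbit_inner_bcontfun[OF T]] asymptotic_limit_cinner[OF T, symmetric]
        cinner_axis_matrix)
  also have "\<dots> = trace (?B ** ?A)"
    by (simp add: trace_matrix_mult)
  finally show ?thesis
    by (simp add: invertible_matrix_inv[OF inv] trace_I)
qed

end

section \<open>Cesaro means of orbits and their limits\<close>

definition cesaro_mean :: "complex ^ 'n ^ 'n \<Rightarrow> nat \<Rightarrow> complex ^ 'n ^ 'n" where
  "cesaro_mean T n = (1 / real n) *\<^sub>R (\<Sum>j=1..n. mat_pow (conj_transpose T) j ** mat_pow T j)"

lemma cinner_cesaro_mean: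
  fixes T :: "complex ^ 'n ^ 'n"
  shows "cinner (cesaro_mean T n *v x) y = (1 / of_nat n) * (\<Sum>j=1..n. orbit_inner T x y j)"
proof -
  have s: "cinner ((\<Sum>j\<in>I. F j) *v x) y = (\<Sum>j\<in>I. cinner (F j *v x) y)"
    for I and F :: "nat \<Rightarrow> complex ^ 'n ^ 'n"
    by (induction I rule: infinite_finite_induct)
      (simp_all add: cinner_add_left matrix_vector_mult_add_rdistrib cinner_zero_left)
  have "cinner ((r *\<^sub>R M) *v x) y = of_real r * cinner (M *v x) y" for r and M :: "complex ^ 'n ^ 'n"
    by (simp add: cinner_def matrix_vector_mult_def scaleR_conv_of_real[where 'a = complex]
        sum_distrib_left sum_distrib_right mult_ac)
  then show ?thesis
    unfolding cesaro_mean_def by (simp add: s orbit_inner_alt)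
qed

lemma tendsto_cinner:
  assumes "X \<longlonglongrightarrow> A"
  shows "(\<lambda>n. cinner (X n *v x) y) \<longlonglongrightarrow> cinner (A *v x) y"
  unfolding cinner_def matrix_vector_mult_def
  by (simp only: vec_lambda_beta) (intro tendsto_intros assms)

lemma tendsto_matrixI:
  fixes X :: "nat \<Rightarrow> complex ^ 'n ^ 'n"
  assumes "\<And>x y. (\<lambda>n. cinner (X n *v x) y) \<longlonglongrightarrow> cinner (A *v x) y"
  shows "X \<longlonglongrightarrow> A"
  using assms[of "axis _ 1" "axis _ 1"] unfolding cinner_axis_matrix by (intro vec_tendstoI) auto

text \<open>A telescoping sum replaces shift invariance: shifting the averaged sequence changes its
  mean by two boundary terms divided by \<open>n\<close>, and these are bounded.\<close>

lemma cesaro_asymptotic_limit_invariant: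
  fixes T :: "complex ^ 'n ^ 'n"
  assumes T: "powerbounded T" and lim: "is_cesaro_asymptotic_limit T A"
  shows "conj_transpose T ** A ** T = A"
proof (rule matrix_eqI_cinner)
  fix x y :: "complex ^ 'n"
  have X: "cesaro_mean T \<longlonglongrightarrow> A"
    using lim by (simp add: is_cesaro_asymptotic_limit_def cesaro_mean_def[abs_def])
  define u where "u = orbit_inner T x y"
  have uS: "orbit_inner T (T *v x) (T *v y) j = u (Suc j)" for j
    by (simp add: u_def orbit_inner_def matrix_vector_mul_assoc mat_pow_commute)
  \<comment> \<open>Boundedness is available from index 1 on. This covers both boundary terms, so
    their difference is at most \<open>K + K\<close>.\<close>
  have "bounded (range (\<lambda>n. u (Suc n)))"
    using orbit_inner_bcontfun[OF T] by (simp add: u_def bcontfun_def)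
  then obtain K where K: "\<And>n. norm (u (Suc n)) \<le> K"
    by (auto simp: bounded_iff)
  have diff: "cinner (cesaro_mean T n *v (T *v x)) (T *v y) - cinner (cesaro_mean T n *v x) y
      = (1 / of_nat n) * (u (Suc n) - u 1)" for n
  proof -
    have "(\<Sum>j=1..n. u (Suc j)) - (\<Sum>j=1..n. u j) = (\<Sum>j=1..n. u (Suc j) - u j)"
      by (simp add: sum_subtractf)
    also have "\<dots> = u (Suc n) - u 1"
      by (induction n) auto
    finally show ?thesis
      unfolding cinner_cesaro_mean uS u_def[symmetric] right_diff_distrib[symmetric] by simp
  qed
  have "(\<lambda>n. (1 / of_nat n) * (u (Suc n) - u 1)) \<longlonglongrightarrow> 0"
  proof (rule lim_null_mult_right_bounded)
    show "(\<lambda>n. 1 / of_nat n :: complex) \<longlonglongrightarrow> 0" by (rule lim_1_over_n)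
    show "\<forall>\<^sub>F n in sequentially. norm (u (Suc n) - u 1) \<le> K + K"
      by (intro always_eventually allI order_trans[OF norm_triangle_ineq4] add_mono) (use K K[of 0] in simp_all)
  qed
  from LIMSEQ_unique[OF this, folded diff, OF tendsto_diff[OF tendsto_cinner[OF X] tendsto_cinner[OF X]]]
  have "cinner (A *v (T *v x)) (T *v y) - cinner (A *v x) y = 0"
    by simp
  then show "cinner ((conj_transpose T ** A ** T) *v x) y = cinner (A *v x) y"
    by (simp add: matrix_vector_mul_assoc[symmetric] cinner_matrix_left[of "conj_transpose T"])
qed

lemma trace_inverse_cesaro_asymptotic_limit:
  fixes T :: "complex ^ 'n ^ 'n"
  assumes T: "powerbounded T" and lim: "is_cesaro_asymptotic_limit T A" and inv: "invertible A"
  shows "trace (matrix_inv A) = of_nat CARD('n)"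
proof -
  let ?B = "matrix_inv A"
  \<comment> \<open>At \<open>n = 0\<close> division by zero makes the mean 0, so the traces are
    only eventually constant.\<close>
  have "trace (?B ** cesaro_mean T n) = trace ?B" if "n > 0" for n
  proof -
    have s: "trace (?B ** (\<Sum>j\<in>I. F j)) = (\<Sum>j\<in>I. trace (?B ** F j))"
      for I and F :: "nat \<Rightarrow> complex ^ 'n ^ 'n"
      by (induction I rule: infinite_finite_induct) (simp_all add: matrix_add_ldistrib trace_add trace_0[simplified])
    have "trace (?B ** cesaro_mean T n) = of_real (1 / real n) *
        trace (?B ** (\<Sum>j=1..n. mat_pow (conj_transpose T) j ** mat_pow T j))"
      unfolding cesaro_mean_def
      by (simp add: trace_def matrix_matrix_mult_def scaleR_conv_of_real[where 'a = complex] sum_distrib_left mult_ac)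
    then show ?thesis
      using that
      by (simp add: s trace_invariant[OF inv cesaro_asymptotic_limit_invariant[OF T lim]])
  qed
  then have "(\<lambda>n. trace (?B ** cesaro_mean T n)) \<longlonglongrightarrow> trace ?B"
    by (intro tendsto_eventually) (auto intro: eventually_mono[OF eventually_gt_at_top[of 0]])
  moreover have "(\<lambda>n. trace (?B ** cesaro_mean T n)) \<longlonglongrightarrow> trace (?B ** A)"
    using lim
    by (intro continuous_trace_mult) (simp add: is_cesaro_asymptotic_limit_def cesaro_mean_def[abs_def])
  ultimately have "trace ?B = trace (?B ** A)"
    by (rule LIMSEQ_unique)
  then show ?thesis
    by (simp add: invertible_matrix_inv[OF inv] trace_I)
qed

subsection \<open>Factorization with unit columns\<close>

text \<open>Both sides are the squared Frobenius norm of \<open>S\<close>, summed in different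
  orders. The trace condition thus says that the squared column norms average to 1.\<close>

lemma trace_mult_conj_transpose:
  fixes S :: "complex ^ 'n ^ 'n"
  shows "trace (S ** conj_transpose S) = of_real (\<Sum>j\<in>UNIV. (norm (column j S))\<^sup>2)"
  unfolding trace_def matrix_matrix_mult_def norm_vec_square of_real_sum complex_norm_square
  by (simp add: column_def) (rule sum.swap)

text \<open>Polarization: the form is real at \<open>x + y\<close> and at
  \<open>x + \<i> *s y\<close>, which settles the imaginary and the real part respectively.\<close>

lemma positive_op_hermitian:
  assumes "positive_op A"
  shows "cinner (A *v y) x = cnj (cinner (A *v x) y)"
proof -
  have im: "Im (cinner (A *v u) u) = 0" for u
    using assms by (metis positive_op_def complex_nonneg_Reals_iff)
  have "Im (cinner (A *v x) y) + Im (cinner (A *v y) x) = 0"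
    using im[of "x + y"] by (simp add: matrix_vector_right_distrib cinner_add_left cinner_add_right im)
  moreover have "Re (cinner (A *v y) x) = Re (cinner (A *v x) y)"
    using im[of "x + \<i> *s y"]
    by (simp add: matrix_vector_right_distrib cinner_add_left cinner_add_right im
        vector_scalar_commute cinner_scale_left cinner_scale_right)
  ultimately show ?thesis
    by (simp add: complex_eq_iff)
qed

text \<open>If the form vanished at some \<open>x \<noteq> 0\<close>, then \<open>z = A *v x\<close>
  would be nonzero and the form along the line \<open>z + t x\<close> would be affine in
  \<open>t\<close> with nonzero slope, hence negative somewhere.\<close>

lemma positive_definite_pos:
  assumes A: "positive_definite A" and "x \<noteq> 0"
  obtains c :: real where "c > 0" "cinner (A *v x) x = of_real c"
proof -
  have pos: "Im (cinner (A *v u) u) = 0" "Re (cinner (A *v u) u) \<ge> 0" for u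
    using A by (metis positive_definite_def positive_op_def complex_nonneg_Reals_iff)+
  have "cinner (A *v x) x \<noteq> 0"
  proof
    assume 0: "cinner (A *v x) x = 0"
    define z where "z = A *v x"
    define b where "b = Re (cinner (A *v z) z)"
    have "inj ((*v) A)"
      using A by (simp add: positive_definite_def inj_matrix_vector_mult)
    then have "z \<noteq> 0"
      unfolding z_def using \<open>x \<noteq> 0\<close> by (metis injD matrix_vector_mult_0_right)
    \<comment> \<open>Solves \<open>b + 2 * t * (norm z)\<^sup>2 = - 1\<close>.\<close>
    define t where "t = - (b + 1) / (2 * (norm z)\<^sup>2)"
    have "cinner (A *v z) x = cnj (cinner (A *v x) z)"
      using A by (intro positive_op_hermitian) (simp add: positive_definite_def)
    then have "Re (cinner (A *v (z + of_real t *s x)) (z + of_real t *s x)) = b + 2 * t * (norm z)\<^sup>2"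
      using 0
      by (simp add: matrix_vector_right_distrib cinner_add_left cinner_add_right b_def
          vector_scalar_commute cinner_scale_left cinner_scale_right cinner_self z_def[symmetric])
    also have "\<dots> = - 1"
      using \<open>z \<noteq> 0\<close> by (simp add: t_def field_simps)
    finally show False
      using pos(2)[of "z + of_real t *s x"] by simp
  qed
  then have "Re (cinner (A *v x) x) > 0"
    using pos[of x] by (simp add: complex_eq_iff)
  then show ?thesis
    using pos(1)[of x] by (intro that[of "Re (cinner (A *v x) x)"]) (auto simp: complex_eq_iff)
qed

text \<open>Gram--Schmidt for the inner product given by \<open>A\<close>.\<close>

lemma positive_definite_orthonormal:
  fixes A :: "complex ^ 'n ^ 'n" and K :: "'n set"
  assumes A: "positive_definite A"
  shows "\<exists>s. \<forall>i\<in>K. \<forall>j\<in>K. cinner (A *v s i) (s j) = (if i = j then 1 else 0)"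
proof (induction K rule: finite_induct[OF finite])
  case (2 k K)
  then obtain s where s: "\<And>i j. i \<in> K \<Longrightarrow> j \<in> K \<Longrightarrow> cinner (A *v s i) (s j) = (if i = j then 1 else 0)"
    by blast
  \<comment> \<open>The kernel of \<open>R\<close> consists of the vectors that are
    \<open>A\<close>-orthogonal to all \<open>s j\<close> with \<open>j \<in> K\<close>. Since
    \<open>k \<notin> K\<close>, row \<open>k\<close> is zero, so \<open>R\<close> is singular and
    such a nonzero vector exists.\<close>
  define R :: "complex ^ 'n ^ 'n" where "R = (\<chi> j l. if j \<in> K then cnj ((A *v s j) $ l) else 0)"
  have "row k R = 0"
    using 2 by (simp add: R_def row_def vec_eq_iff)
  then have "\<not> invertible R"
    by (simp add: invertible_det_nz det_zero_row)
  then obtain x where x: "R *v x = 0" "x \<noteq> 0"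
    using invertible_left_inverse matrix_left_invertible_ker by blast
  have R: "cinner x (A *v s j) = (R *v x) $ j" if "j \<in> K" for j
    using that by (simp add: R_def cinner_def matrix_vector_mult_def mult.commute)
  have xs: "cinner (A *v s j) x = 0" if "j \<in> K" for j
    using R[OF that] x cinner_commute[of "A *v s j" x] by simp
  have sx: "cinner (A *v x) (s j) = 0" if "j \<in> K" for j
    using xs[OF that] positive_op_hermitian[of A x "s j"] A by (simp add: positive_definite_def)
  obtain c where c: "c > 0" "cinner (A *v x) x = of_real c"
    using positive_definite_pos[OF A x(2)] .
  \<comment> \<open>The factor normalizes \<open>x\<close> to length 1 for the form given by
    \<open>A\<close>.\<close>
  define s' where "s' = s(k := of_real (1 / sqrt c) *s x)"
  have "of_real (1 / sqrt c) * (of_real (1 / sqrt c) * of_real c) = (1 :: complex)"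
    using c(1) by (simp only: of_real_mult[symmetric]) (simp add: field_simps real_sqrt_mult_self)
  then have "\<forall>i\<in>insert k K. \<forall>j\<in>insert k K. cinner (A *v s' i) (s' j) = (if i = j then 1 else 0)"
    using 2 s xs sx c(2)
    by (auto simp: s'_def vector_scalar_commute cinner_scale_left cinner_scale_right)
  then show ?case by blast
qed simp

text \<open>Take an \<open>A\<close>-orthonormal basis as the columns of \<open>S\<close>. Then
  \<open>S\<^sup>* A S = 1\<close>, and moving one-sided inverses to the other side yields
  \<open>A S S\<^sup>* = 1\<close>.\<close>

lemma positive_definite_factorization:
  fixes A :: "complex ^ 'n ^ 'n"
  assumes "positive_definite A"
  obtains S :: "complex ^ 'n ^ 'n" where "S ** conj_transpose S = matrix_inv A"
proof -
  have "\<exists>s. \<forall>i j :: 'n. cinner (A *v s i) (s j) = (if i = j then 1 else 0)"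
    using positive_definite_orthonormal[OF assms, of UNIV] by (simp only: ball_UNIV)
  then obtain s where s: "\<And>i j :: 'n. cinner (A *v s i) (s j) = (if i = j then 1 else 0)"
    by blast
  define S :: "complex ^ 'n ^ 'n" where "S = (\<chi> i j. s j $ i)"
  have col: "S *v axis j 1 = s j" for j
    by (simp add: matrix_mult_axis S_def column_def vec_eq_iff)
  have "(conj_transpose S ** A ** S) $ i $ j = mat 1 $ i $ j" for i j
    unfolding cinner_axis_matrix[symmetric, of "conj_transpose S ** A ** S"]
    by (simp add: matrix_vector_mul_assoc[symmetric] cinner_matrix_left[of "conj_transpose S"] col s mat_def)
  then have "(conj_transpose S ** A) ** S = mat 1"
    by (simp add: vec_eq_iff)
  then have "(S ** conj_transpose S) ** A = mat 1"
    using matrix_left_right_inverse by (metis matrix_mul_assoc)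
  then have "A ** (S ** conj_transpose S) = mat 1"
    using matrix_left_right_inverse by blast
  from matrix_inv_eqI(1)[OF this] show ?thesis
    by (intro that) simp
qed

text \<open>A rotation in the plane of coordinates \<open>j\<close> and \<open>k\<close> multiplies
  \<open>S\<close> on the right by an orthogonal matrix, which cancels in
  \<open>S S\<^sup>*\<close>.\<close>

lemma rotate_columns:
  fixes S :: "complex ^ 'n ^ 'n"
  assumes "norm (column j S) < 1" "1 < norm (column k S)"
  obtains S' :: "complex ^ 'n ^ 'n" where "S' ** conj_transpose S' = S ** conj_transpose S"
    "norm (column j S') = 1" "\<And>i. i \<noteq> j \<Longrightarrow> i \<noteq> k \<Longrightarrow> column i S' = column i S"
proof -
  have jk: "j \<noteq> k" using assms by auto
  define f where "f t = norm (cos t *\<^sub>R column j S + sin t *\<^sub>R column k S)" for t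
  \<comment> \<open>At angle 0 the rotated column is column \<open>j\<close>, shorter than 1; at
    \<open>pi / 2\<close> it is column \<open>k\<close>, longer than 1.\<close>
  have "\<exists>t\<ge>0. t \<le> pi / 2 \<and> f t = 1"
    using assms by (intro IVT') (auto simp: f_def intro!: continuous_intros)
  then obtain t where t: "f t = 1" by blast
  define a b where "a = complex_of_real (cos t)" and "b = complex_of_real (sin t)"
  have ab: "a * a + b * b = 1"
    unfolding a_def b_def by (metis of_real_1 of_real_add of_real_mult power2_eq_square sin_cos_squared_add2)
  have cnj: "cnj a = a" "cnj b = b"
    by (simp_all add: a_def b_def)
  define S' :: "complex ^ 'n ^ 'n" where
    "S' = (\<chi> l i. if i = j then a * S $ l $ j + b * S $ l $ k
                  else if i = k then a * S $ l $ k - b * S $ l $ j else S $ l $ i)"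
  have "(S' ** conj_transpose S') $ l $ m = (S ** conj_transpose S) $ l $ m" for l m
  proof -
    have split: "sum g UNIV = g j + (g k + sum g (UNIV - {j} - {k}))" for g :: "'n \<Rightarrow> complex"
      using jk by (simp add: sum.remove[of _ j] sum.remove[of _ k])
    have "(\<Sum>i\<in>UNIV - {j} - {k}. S' $ l $ i * cnj (S' $ m $ i)) = (\<Sum>i\<in>UNIV - {j} - {k}. S $ l $ i * cnj (S $ m $ i))"
      by (intro sum.cong refl) (simp add: S'_def)
    moreover have "S' $ l $ j * cnj (S' $ m $ j) + S' $ l $ k * cnj (S' $ m $ k)
      = (a * a + b * b) * (S $ l $ j * cnj (S $ m $ j) + S $ l $ k * cnj (S $ m $ k))"
      using jk by (simp add: S'_def cnj algebra_simps)
    ultimately show ?thesis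
      by (simp add: matrix_matrix_mult_def split[of "\<lambda>i. _ i * cnj (_ i)"] ab add.assoc[symmetric])
  qed
  then have "S' ** conj_transpose S' = S ** conj_transpose S"
    by (simp add: vec_eq_iff)
  moreover have "column j S' = cos t *\<^sub>R column j S + sin t *\<^sub>R column k S"
    by (simp add: S'_def column_def vec_eq_iff a_def b_def scaleR_conv_of_real[where 'a = complex])
  then have "norm (column j S') = 1"
    using t by (simp add: f_def)
  moreover have "column i S' = column i S" if "i \<noteq> j" "i \<noteq> k" for i
    using that by (simp add: S'_def column_def vec_eq_iff)
  ultimately show ?thesis using that by blast
qed

lemma unit_columns:
  fixes S :: "complex ^ 'n ^ 'n"
  assumes "trace (S ** conj_transpose S) = of_nat CARD('n)"
  shows "\<exists>S' :: complex ^ 'n ^ 'n. S' ** conj_transpose S' = S ** conj_transpose S \<and> (\<forall>j. norm (column j S') = 1)"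
  using assms
proof (induction "card {j. norm (column j S) \<noteq> 1}" arbitrary: S rule: less_induct)
  case less
  show ?case
  proof (cases "\<forall>j. norm (column j S) = 1")
    case False
    have "complex_of_real (\<Sum>j\<in>UNIV. (norm (column j S))\<^sup>2) = of_real (real CARD('n))"
      using less.prems unfolding trace_mult_conj_transpose by simp
    then have "(\<Sum>j\<in>UNIV. (norm (column j S))\<^sup>2) = real CARD('n)"
      by (simp only: of_real_eq_iff)
    then have eq: "(\<Sum>j\<in>UNIV. (norm (column j S))\<^sup>2) = (\<Sum>j\<in>(UNIV :: 'n set). 1)"
      by simp
    have "\<exists>j. norm (column j S) < 1"
    proof (rule ccontr)
      assume "\<nexists>j. norm (column j S) < 1"
      then have ge: "1 \<le> norm (column j S)" for j
        by (simp add: not_less)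
      \<comment> \<open>Termwise comparable sums with equal totals agree in every term.\<close>
      have "(norm (column j S))\<^sup>2 = 1\<^sup>2" for j
        unfolding one_power2 by (rule sum_mono_inv[OF eq[symmetric], symmetric]) (simp_all add: one_le_power ge)
      then have "norm (column j S) = 1" for j
        by (rule power2_eq_imp_eq) simp_all
      with False show False by blast
    qed
    moreover have "\<exists>k. 1 < norm (column k S)"
    proof (rule ccontr)
      assume "\<nexists>k. 1 < norm (column k S)"
      then have le: "norm (column j S) \<le> 1" for j
        by (simp add: not_less)
      have "(norm (column j S))\<^sup>2 = 1\<^sup>2" for j
        unfolding one_power2 by (rule sum_mono_inv[OF eq]) (simp_all add: power_le_one le)
      then have "norm (column j S) = 1" for j
        by (rule power2_eq_imp_eq) simp_all
      with False show False by blast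
    qed
    ultimately obtain j k where jk: "norm (column j S) < 1" "1 < norm (column k S)"
      by blast
    obtain S' :: "complex ^ 'n ^ 'n" where S': "S' ** conj_transpose S' = S ** conj_transpose S"
      "norm (column j S') = 1" "\<And>i. i \<noteq> j \<Longrightarrow> i \<noteq> k \<Longrightarrow> column i S' = column i S"
      using rotate_columns[OF jk] by blast
    \<comment> \<open>Only columns \<open>j\<close> and \<open>k\<close> change. Column
      \<open>j\<close> leaves the set, and \<open>k\<close> was already in it, so its new length
      does not matter.\<close>
    have "{i. norm (column i S') \<noteq> 1} \<subset> {i. norm (column i S) \<noteq> 1}"
    proof
      show "{i. norm (column i S') \<noteq> 1} \<subseteq> {i. norm (column i S) \<noteq> 1}"
      proof
        fix i assume "i \<in> {i. norm (column i S') \<noteq> 1}"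
        with S'(2,3) jk(2) show "i \<in> {i. norm (column i S) \<noteq> 1}"
          by (cases "i = j"; cases "i = k") auto
      qed
      have "j \<in> {i. norm (column i S) \<noteq> 1}" "j \<notin> {i. norm (column i S') \<noteq> 1}"
        using S'(2) jk(1) by simp_all
      then show "{i. norm (column i S') \<noteq> 1} \<noteq> {i. norm (column i S) \<noteq> 1}"
        by blast
    qed
    then have "card {i. norm (column i S') \<noteq> 1} < card {i. norm (column i S) \<noteq> 1}"
      by (intro psubset_card_mono) auto
    from less.hyps[OF this, unfolded S'(1), OF less.prems] show ?thesis .
  next
    case True
    then show ?thesis
      by (intro exI[of _ S]) simp
  qed
qed

subsection \<open>Matrices similar to a diagonal unitary matrix\<close>

definition diag_mat :: "('n \<Rightarrow> complex) \<Rightarrow> complex ^ 'n ^ 'n" where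
  "diag_mat z = (\<chi> i j. if i = j then z i else 0)"

lemma diag_mat_mult_vec: "(diag_mat z *v x) $ i = z i * x $ i"
  by (simp add: diag_mat_def matrix_vector_mult_def if_distrib if_distribR cong: if_cong)

lemma diag_mat_mult: "diag_mat z ** diag_mat w = diag_mat (\<lambda>i. z i * w i)"
  unfolding matrix_eq vec_eq_iff
  by (simp add: matrix_vector_mul_assoc[symmetric] diag_mat_mult_vec mult.assoc)

lemma diag_mat_1: "diag_mat (\<lambda>_. 1) = mat 1"
  by (simp add: diag_mat_def mat_def)

lemma conj_transpose_diag_mat: "conj_transpose (diag_mat z) = diag_mat (\<lambda>i. cnj (z i))"
  by (simp add: vec_eq_iff diag_mat_def)

lemma mat_pow_conj_diag:
  fixes S :: "complex ^ 'n ^ 'n"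
  assumes "invertible S"
  shows "mat_pow (S ** diag_mat z ** matrix_inv S) n = S ** diag_mat (\<lambda>i. z i ^ n) ** matrix_inv S"
proof (induction n)
  case (Suc n)
  have "S ** diag_mat z ** matrix_inv S ** (S ** diag_mat (\<lambda>i. z i ^ n) ** matrix_inv S)
      = S ** diag_mat z ** (matrix_inv S ** S) ** diag_mat (\<lambda>i. z i ^ n) ** matrix_inv S"
    by (simp add: matrix_mul_assoc)
  also have "\<dots> = S ** (diag_mat z ** diag_mat (\<lambda>i. z i ^ n)) ** matrix_inv S"
    by (simp add: invertible_matrix_inv[OF assms] matrix_mul_assoc)
  finally show ?case
    by (simp add: Suc diag_mat_mult)
qed (simp add: diag_mat_1 invertible_matrix_inv[OF assms])

lemma invertible_conj_transpose:
  fixes M :: "complex ^ 'n ^ 'n"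
  assumes "invertible M"
  shows "matrix_inv (conj_transpose M) = conj_transpose (matrix_inv M)" "invertible (conj_transpose M)"
proof -
  have "conj_transpose M ** conj_transpose (matrix_inv M) = mat 1"
    by (simp add: conj_transpose_mult[symmetric] invertible_matrix_inv[OF assms])
  from matrix_inv_eqI[OF this]
  show "matrix_inv (conj_transpose M) = conj_transpose (matrix_inv M)" "invertible (conj_transpose M)"
    by simp_all
qed

lemma invertible_matrix_inv_inv:
  assumes "invertible (M :: 'a :: field ^ 'n ^ 'n)"
  shows "matrix_inv (matrix_inv M) = M" "invertible (matrix_inv M)"
  using matrix_inv_eqI[OF invertible_matrix_inv(2)[OF assms]] by simp_all

text \<open>Powers of the diagonal factor are isometries, so all powers of the product share the
  bound given by the norms of \<open>S\<close> and its inverse.\<close>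

lemma powerbounded_conj_diag:
  fixes S :: "complex ^ 'n ^ 'n"
  assumes S: "invertible S" and z: "\<And>i. norm (z i) = 1"
  shows "powerbounded (S ** diag_mat z ** matrix_inv S)"
proof -
  let ?o = "\<lambda>M :: complex ^ _ ^ _. onorm ((*v) M)"
  note bl = matrix_vector_mul_bounded_linear
  have bound: "?o (mat_pow (S ** diag_mat z ** matrix_inv S) n) \<le> ?o S * ?o (matrix_inv S)" for n
  proof (rule onorm_bound)
    fix x
    have "norm (diag_mat (\<lambda>i. z i ^ n) *v y) = norm y" for y
      by (simp add: norm_vec_def diag_mat_mult_vec norm_mult norm_power z)
    then have "norm (mat_pow (S ** diag_mat z ** matrix_inv S) n *v x) \<le> ?o S * norm (matrix_inv S *v x)"
      unfolding mat_pow_conj_diag[OF S] matrix_vector_mul_assoc[symmetric]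
      using onorm[OF bl, of S "diag_mat (\<lambda>i. z i ^ n) *v (matrix_inv S *v x)"] by simp
    also have "\<dots> \<le> ?o S * (?o (matrix_inv S) * norm x)"
      by (intro mult_left_mono onorm bl onorm_pos_le)
    finally show "norm (mat_pow (S ** diag_mat z ** matrix_inv S) n *v x) \<le> ?o S * ?o (matrix_inv S) * norm x"
      by (simp add: mult.assoc)
  qed (simp add: onorm_pos_le bl)
  \<comment> \<open>Adding 1 makes the bound strict and positive, as \<open>powerbounded\<close>
    demands.\<close>
  have "?o (mat_pow (S ** diag_mat z ** matrix_inv S) n) < ?o S * ?o (matrix_inv S) + 1" for n
    using bound[of n] by linarith
  moreover have "0 < ?o S * ?o (matrix_inv S) + 1"
    by (simp add: onorm_pos_le bl add_nonneg_pos)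
  ultimately show ?thesis
    unfolding powerbounded_def by blast
qed

text \<open>Orbit products become finite combinations of geometric sequences, with coefficients
  independent of \<open>n\<close>. Both kinds of limit then only have to be computed on such
  sequences.\<close>

lemma orbit_inner_conj_diag:
  fixes S :: "complex ^ 'n ^ 'n"
  assumes "invertible S"
  shows "orbit_inner (S ** diag_mat z ** matrix_inv S) x y n =
    (\<Sum>i\<in>UNIV. \<Sum>k\<in>UNIV. (conj_transpose S ** S) $ i $ k * (matrix_inv S *v x) $ k *
      cnj ((matrix_inv S *v y) $ i) * (z k * cnj (z i)) ^ n)"
proof -
  let ?D = "diag_mat (\<lambda>i. z i ^ n)"
  have "orbit_inner (S ** diag_mat z ** matrix_inv S) x y n
      = cinner (S *v (?D *v (matrix_inv S *v x))) (S *v (?D *v (matrix_inv S *v y)))"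
    unfolding orbit_inner_def mat_pow_conj_diag[OF assms] by (simp add: matrix_vector_mul_assoc matrix_mul_assoc)
  also have "\<dots> = cinner ((conj_transpose S ** S) *v (?D *v (matrix_inv S *v x))) (?D *v (matrix_inv S *v y))"
    by (simp only: cinner_matrix_left[of "conj_transpose S"] conj_transpose_conj_transpose
        matrix_vector_mul_assoc[symmetric, of "conj_transpose S"])
  also have "\<dots> = (\<Sum>i\<in>UNIV. \<Sum>k\<in>UNIV. (conj_transpose S ** S) $ i $ k * (matrix_inv S *v x) $ k *
      cnj ((matrix_inv S *v y) $ i) * (z k * cnj (z i)) ^ n)"
    unfolding cinner_def matrix_vector_mult_def[of "conj_transpose S ** S"]
    by (simp add: diag_mat_mult_vec sum_distrib_left sum_distrib_right power_mult_distrib mult_ac)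
  finally show ?thesis .
qed

text \<open>The diagonal part of the Gram matrix \<open>S\<^sup>* S\<close>, transported by the
  inverse of \<open>S\<close>. Arbitrary column norms are allowed because the adjoint of
  \<open>T\<close> leads to the inverse adjoint of \<open>S\<close>, whose columns need not be unit
  vectors.\<close>

definition column_limit :: "complex ^ 'n ^ 'n \<Rightarrow> complex ^ 'n ^ 'n" where
  "column_limit S = conj_transpose (matrix_inv S) **
     diag_mat (\<lambda>i. of_real ((norm (column i S))\<^sup>2)) ** matrix_inv S"

text \<open>Written as a double sum with a Kronecker delta to match
  \<open>orbit_inner_conj_diag\<close>, the delta standing for the limit of the powers.\<close>

lemma cinner_column_limit:
  "cinner (column_limit S *v x) y = (\<Sum>i\<in>UNIV. \<Sum>k\<in>UNIV. (conj_transpose S ** S) $ i $ k *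
    (matrix_inv S *v x) $ k * cnj ((matrix_inv S *v y) $ i) * (if k = i then 1 else 0))"
proof -
  have "(conj_transpose S ** S) $ i $ i = of_real ((norm (column i S))\<^sup>2)" for i
    unfolding norm_vec_square of_real_sum complex_norm_square
    by (simp add: matrix_matrix_mult_def column_def mult.commute)
  moreover have "cinner (column_limit S *v x) y =
     cinner (diag_mat (\<lambda>i. of_real ((norm (column i S))\<^sup>2)) *v (matrix_inv S *v x)) (matrix_inv S *v y)"
    unfolding column_limit_def matrix_vector_mul_assoc[symmetric]
    by (simp only: cinner_matrix_left[of "conj_transpose (matrix_inv S)"] conj_transpose_conj_transpose)
  ultimately show ?thesis
    by (simp add: cinner_def diag_mat_mult_vec if_distrib cong: if_cong)
qed

lemma invertible_column_limit:
  fixes S :: "complex ^ 'n ^ 'n"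
  assumes S: "invertible S"
  shows "invertible (column_limit S)"
proof -
  have "column i S \<noteq> 0" for i
  proof
    assume "column i S = 0"
    then have "S *v axis i 1 = 0"
      by (simp add: matrix_mult_axis)
    then have "axis i (1 :: complex) = 0"
      using inj_matrix_vector_mult[OF S] by (metis injD matrix_vector_mult_0_right)
    then show False by (simp add: axis_eq_0_iff)
  qed
  then have "diag_mat (\<lambda>i. of_real ((norm (column i S))\<^sup>2)) **
      diag_mat (\<lambda>i. 1 / of_real ((norm (column i S))\<^sup>2)) = mat 1"
    unfolding diag_mat_mult by (simp add: diag_mat_1)
  then have "invertible (diag_mat (\<lambda>i. of_real ((norm (column i S))\<^sup>2)))"
    by (rule matrix_inv_eqI)
  then show ?thesis
    unfolding column_limit_def
    by (intro invertible_mult invertible_conj_transpose invertible_matrix_inv_inv S)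
qed

lemma unimodular_mult_cnj_eq_1:
  assumes "norm z = 1" "norm w = 1"
  shows "z * cnj w = 1 \<longleftrightarrow> z = w"
proof -
  have "w * cnj w = 1"
    using assms complex_norm_square[of w] by simp
  then have "z * cnj w = 1 \<longleftrightarrow> z * cnj w = w * cnj w" "w \<noteq> 0"
    by auto
  then show ?thesis
    by simp
qed

text \<open>Distinct unimodular entries make the ratio \<open>w i k\<close> equal to 1 only for
  \<open>i = k\<close>, so \<open>L\<close> annihilates every off-diagonal geometric
  sequence.\<close>

lemma asymptotic_limit_conj_diag:
  fixes S :: "complex ^ 'n ^ 'n"
  assumes L: "banach_limit L" and S: "invertible S" and z: "\<And>i. norm (z i) = 1" "inj z"
  shows "asymptotic_limit L (S ** diag_mat z ** matrix_inv S) = column_limit S"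
proof (rule matrix_eqI_cinner)
  fix x y
  let ?T = "S ** diag_mat z ** matrix_inv S"
  define c where "c i k = (conj_transpose S ** S) $ i $ k *
    (matrix_inv S *v x) $ k * cnj ((matrix_inv S *v y) $ i)" for i k
  define w where "w i k = z k * cnj (z i)" for i k
  have w: "norm (w i k) = 1" "w i k = 1 \<longleftrightarrow> k = i" for i k
    using z unimodular_mult_cnj_eq_1[of "z k" "z i"] by (auto simp: w_def norm_mult inj_eq)
  have b: "(\<lambda>n. w i k ^ n) \<in> bcontfun" for i k
    using w by (auto simp: bcontfun_def norm_power intro!: boundedI[of _ 1])
  have p: "(\<lambda>n. w i k ^ Suc n) \<in> bcontfun" for i k
    using bcontfun_mult[OF b] by simp
  have "cinner (asymptotic_limit L ?T *v x) y
      = seq_lim L (\<lambda>n. \<Sum>i\<in>UNIV. \<Sum>k\<in>UNIV. c i k * w i k ^ Suc n)"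
    unfolding asymptotic_limit_cinner[OF L powerbounded_conj_diag[OF S z(1)]]
      orbit_inner_conj_diag[OF S] c_def w_def ..
  also have "\<dots> = (\<Sum>i\<in>UNIV. \<Sum>k\<in>UNIV. seq_lim L (\<lambda>n. c i k * w i k ^ Suc n))"
    by (simp only: seq_lim_sum[OF L] bcontfun_mult p)
  \<comment> \<open>Shift invariance absorbs the offset in \<open>Suc n\<close>.\<close>
  also have "\<dots> = (\<Sum>i\<in>UNIV. \<Sum>k\<in>UNIV. c i k * (if k = i then 1 else 0))"
    by (simp only: seq_lim_mult[OF L p] seq_lim_Suc[OF L b] seq_lim_power[OF L w(1)] w(2))
  finally show "cinner (asymptotic_limit L ?T *v x) y = cinner (column_limit S *v x) y"
    unfolding cinner_column_limit c_def .
qed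

text \<open>For \<open>w \<noteq> 1\<close> the geometric sums stay below
  \<open>2 / norm (1 - w)\<close>, so dividing by \<open>n\<close> sends them to 0.\<close>

lemma cesaro_power:
  fixes w :: complex
  assumes "norm w = 1"
  shows "(\<lambda>n. (1 / of_nat n) * (\<Sum>j=1..n. w ^ j)) \<longlonglongrightarrow> (if w = 1 then 1 else 0)"
proof (cases "w = 1")
  case True
  have "eventually (\<lambda>n. (1 / of_nat n) * (\<Sum>j=1..n. w ^ j) = 1) sequentially"
    using eventually_gt_at_top[of 0] by eventually_elim (simp add: True)
  with True show ?thesis
    by (simp add: tendsto_eventually)
next
  case False
  have "norm (\<Sum>j=1..n. w ^ j) \<le> 2 / norm (1 - w)" for n
  proof -
    have "(1 - w) * (\<Sum>j=1..n. w ^ j) = w - w ^ Suc n"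
    proof (induction n)
      case (Suc n)
      have "(1 - w) * (\<Sum>j=1..Suc n. w ^ j) = (1 - w) * (\<Sum>j=1..n. w ^ j) + (1 - w) * w ^ Suc n"
        by (simp add: distrib_left)
      also have "\<dots> = w - w ^ Suc (Suc n)"
        unfolding Suc by (simp add: algebra_simps)
      finally show ?case .
    qed simp
    then have "norm (1 - w) * norm (\<Sum>j=1..n. w ^ j) = norm (w - w ^ Suc n)"
      by (metis norm_mult)
    also have "\<dots> \<le> norm w + norm (w ^ Suc n)"
      by (rule norm_triangle_ineq4)
    finally show ?thesis
      using False assms by (simp add: norm_power norm_mult field_simps)
  qed
  then have "(\<lambda>n. (1 / of_nat n) * (\<Sum>j=1..n. w ^ j)) \<longlonglongrightarrow> 0"
    by (intro lim_null_mult_right_bounded[OF lim_1_over_n, where B = "2 / norm (1 - w)"]) simp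
  with False show ?thesis by simp
qed

lemma cesaro_asymptotic_limit_conj_diag:
  fixes S :: "complex ^ 'n ^ 'n"
  assumes S: "invertible S" and z: "\<And>i. norm (z i) = 1" "inj z"
  shows "is_cesaro_asymptotic_limit (S ** diag_mat z ** matrix_inv S) (column_limit S)"
proof -
  let ?T = "S ** diag_mat z ** matrix_inv S"
  have "cesaro_mean ?T \<longlonglongrightarrow> column_limit S"
  proof (rule tendsto_matrixI)
    fix x y
    define c where "c i k = (conj_transpose S ** S) $ i $ k *
      (matrix_inv S *v x) $ k * cnj ((matrix_inv S *v y) $ i)" for i k
    define w where "w i k = z k * cnj (z i)" for i k
    have w: "norm (w i k) = 1" "w i k = 1 \<longleftrightarrow> k = i" for i k
      using z unimodular_mult_cnj_eq_1[of "z k" "z i"] by (auto simp: w_def norm_mult inj_eq)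
    have "cinner (cesaro_mean ?T n *v x) y
        = (\<Sum>i\<in>UNIV. \<Sum>k\<in>UNIV. c i k * ((1 / of_nat n) * (\<Sum>j=1..n. w i k ^ j)))" for n
    proof -
      have "(\<Sum>j=1..n. \<Sum>i\<in>UNIV. \<Sum>k\<in>UNIV. c i k * w i k ^ j)
          = (\<Sum>i\<in>UNIV. \<Sum>k\<in>UNIV. c i k * (\<Sum>j=1..n. w i k ^ j))"
        unfolding sum_distrib_left by (subst sum.swap) (intro sum.cong refl sum.swap)
      then show ?thesis
        unfolding cinner_cesaro_mean orbit_inner_conj_diag[OF S] c_def[symmetric] w_def[symmetric]
        by (simp add: sum_distrib_left mult_ac)
    qed
    moreover have "(\<lambda>n. \<Sum>i\<in>UNIV. \<Sum>k\<in>UNIV. c i k * ((1 / of_nat n) * (\<Sum>j=1..n. w i k ^ j)))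
        \<longlonglongrightarrow> (\<Sum>i\<in>UNIV. \<Sum>k\<in>UNIV. c i k * (if w i k = 1 then 1 else 0))"
      by (intro tendsto_sum tendsto_mult tendsto_const cesaro_power w)
    ultimately show "(\<lambda>n. cinner (cesaro_mean ?T n *v x) y) \<longlonglongrightarrow> cinner (column_limit S *v x) y"
      unfolding cinner_column_limit c_def[symmetric] w(2) by simp
  qed
  then show ?thesis
    by (simp add: is_cesaro_asymptotic_limit_def cesaro_mean_def[abs_def])
qed

text \<open>The adjoint has the same shape, with the inverse adjoint of \<open>S\<close> and
  conjugated diagonal entries, so both asymptotic limits are invertible by
  \<open>invertible_column_limit\<close>.\<close>

lemma conj_diag_in_C11:
  fixes S :: "complex ^ 'n ^ 'n"
  assumes L: "banach_limit L" and S: "invertible S" and z: "\<And>i. norm (z i) = 1" "inj z"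
  shows "S ** diag_mat z ** matrix_inv S \<in> C11 L"
proof -
  let ?S = "conj_transpose (matrix_inv S)"
  have S': "invertible ?S" "matrix_inv ?S = conj_transpose S"
    using S by (simp_all add: invertible_conj_transpose invertible_matrix_inv_inv)
  have z': "norm (cnj (z i)) = 1" "inj (\<lambda>i. cnj (z i))" for i
    using z by (auto simp: inj_def)
  have "conj_transpose (S ** diag_mat z ** matrix_inv S) = ?S ** diag_mat (\<lambda>i. cnj (z i)) ** matrix_inv ?S"
    by (simp add: conj_transpose_mult conj_transpose_diag_mat S' matrix_mul_assoc)
  then show ?thesis
    using asymptotic_limit_conj_diag[OF L S z] asymptotic_limit_conj_diag[OF L S'(1) z']
      powerbounded_conj_diag[OF S z(1)]
    by (simp add: C11_def inj_matrix_vector_mult invertible_column_limit S S')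
qed

text \<open>Enumerate the roots of unity of order \<open>CARD('n)\<close>.\<close>

lemma distinct_unimodular:
  obtains z :: "'n :: finite \<Rightarrow> complex" where "\<And>i. norm (z i) = 1" "inj z"
proof -
  let ?R = "{u :: complex. u ^ CARD('n) = 1}"
  have "card ?R = CARD('n)"
    by (simp add: card_roots_unity_eq)
  moreover have "finite ?R"
    by (rule finite_roots_unity) (simp add: Suc_leI)
  ultimately obtain z where z: "bij_betw z (UNIV :: 'n set) ?R"
    using finite_same_card_bij[of "UNIV :: 'n set" ?R] by auto
  have "norm (z i) ^ CARD('n) = 1" for i
    using bij_betwE[OF z] by (simp add: norm_power[symmetric])
  then have "norm (z i) = 1" for i
    using power_eq_1_iff[of "norm (z i)" "CARD('n)"] by simp
  with z show ?thesis
    by (intro that) (auto simp: bij_betw_def)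
qed

lemma matrix_inv_mult_conj_transpose:
  fixes S :: "complex ^ 'n ^ 'n"
  assumes S: "invertible S"
  shows "matrix_inv (S ** conj_transpose S) = conj_transpose (matrix_inv S) ** matrix_inv S"
proof (rule matrix_inv_eqI)
  have "S ** conj_transpose S ** (conj_transpose (matrix_inv S) ** matrix_inv S)
      = S ** conj_transpose (matrix_inv S ** S) ** matrix_inv S"
    by (simp add: conj_transpose_mult matrix_mul_assoc)
  then show "S ** conj_transpose S ** (conj_transpose (matrix_inv S) ** matrix_inv S) = mat 1"
    by (simp add: invertible_matrix_inv[OF S])
qed

section \<open>The equivalences, each reduced to the trace condition on the inverse\<close>

theorem theorem2:
  fixes L :: "(nat \<Rightarrow>\<^sub>C complex) \<Rightarrow> complex"
    and A :: "complex ^ 'd ^ 'd"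
  assumes "banach_limit L"
    and "positive_definite A"
  shows
    "((\<exists>T \<in> C11 L. is_cesaro_asymptotic_limit T A) \<longleftrightarrow>
        (\<Sum>t\<in>#eigenvalues A. 1 / t) = of_nat CARD('d)) \<and>
     ((\<exists>T \<in> C11 L. A = asymptotic_limit L T) \<longleftrightarrow>
        (\<Sum>t\<in>#eigenvalues A. 1 / t) = of_nat CARD('d)) \<and>
     ((\<exists>S :: complex ^ 'd ^ 'd. invertible S \<and> (\<forall>j. norm (column j S) = 1) \<and>
          A = matrix_inv (conj_transpose S) ** matrix_inv S \<and>
          A = matrix_inv (S ** conj_transpose S)) \<longleftrightarrow>
        (\<Sum>t\<in>#eigenvalues A. 1 / t) = of_nat CARD('d))"
    (is "(?cesaro \<longleftrightarrow> ?eig) \<and> (?limit \<longleftrightarrow> ?eig) \<and> (?factor \<longleftrightarrow> ?eig)")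
proof -
  note L = assms(1)
  have A: "invertible A"
    using assms(2) by (simp add: positive_definite_def)
  have eig: "?eig \<longleftrightarrow> trace (matrix_inv A) = of_nat CARD('d)"
    using sum_inverse_eigenvalues[OF A] by simp
  have "?cesaro \<Longrightarrow> ?eig"
    unfolding eig using trace_inverse_cesaro_asymptotic_limit[OF _ _ A] by (auto simp: C11_def)
  moreover have "?limit \<Longrightarrow> ?eig"
    unfolding eig using trace_inverse_asymptotic_limit[OF L] A by (auto simp: C11_def)
  moreover have "?eig \<Longrightarrow> ?factor"
  proof -
    assume ?eig
    obtain S0 :: "complex ^ 'd ^ 'd" where S0: "S0 ** conj_transpose S0 = matrix_inv A"
      using positive_definite_factorization[OF assms(2)] by blast
    then obtain S :: "complex ^ 'd ^ 'd" where S: "S ** conj_transpose S = matrix_inv A"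
        "\<forall>j. norm (column j S) = 1"
      using unit_columns[of S0] \<open>?eig\<close> unfolding eig by auto
    have "S ** (conj_transpose S ** A) = mat 1"
      using S(1) by (simp add: matrix_mul_assoc invertible_matrix_inv[OF A])
    then have inv: "invertible S"
      by (rule matrix_inv_eqI)
    have "A = matrix_inv (S ** conj_transpose S)"
      by (simp add: S(1) invertible_matrix_inv_inv[OF A])
    with S(2) inv show ?factor
      using matrix_inv_mult_conj_transpose[OF inv] invertible_conj_transpose(1)[OF inv] by auto
  qed
  \<comment> \<open>A single \<open>T = S diag(z) S\<^sup>-\<^sup>1\<close> serves for both limits.
    The eigenvalue condition holds because \<open>S S\<^sup>*\<close> has as trace the sum of the
    squared column norms.\<close>
  moreover have "?cesaro \<and> ?limit \<and> ?eig" if ?factor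
  proof -
    from that obtain S :: "complex ^ 'd ^ 'd" where S: "invertible S"
        "\<And>j. norm (column j S) = 1" "A = matrix_inv (S ** conj_transpose S)"
      by blast
    have "trace (matrix_inv A) = of_nat CARD('d)"
      using S(3) invertible_matrix_inv_inv(1)[of "S ** conj_transpose S"]
      by (simp add: trace_mult_conj_transpose S(2) invertible_mult invertible_conj_transpose S(1))
    \<comment> \<open>Unit columns turn the diagonal factor of \<open>column_limit S\<close> into
      the identity.\<close>
    moreover have A_eq: "A = column_limit S"
      by (simp add: S column_limit_def diag_mat_1 matrix_inv_mult_conj_transpose)
    obtain z :: "'d \<Rightarrow> complex" where z: "\<And>i. norm (z i) = 1" "inj z"
      using distinct_unimodular by blast
    ultimately show ?thesis
      using conj_diag_in_C11[OF L S(1) z] asymptotic_limit_conj_diag[OF L S(1) z, folded A_eq]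
        cesaro_asymptotic_limit_conj_diag[OF S(1) z, folded A_eq] unfolding eig by blast
  qed
  ultimately show ?thesis by blast
qed

end
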